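(* Let $n\geq 3$ and $1\leq k\leq n-1$ be integers, and let $p(z)=z^{n} + a_{n-1} z^{n-1} + \dots + a_1 z + a_0$ be a polynomial with complex coefficients such that $a_0 a_k \neq 0$. Let $$\phi(x)=x^{n} + |a_{n-1}| x^{n-1} + \dots + |a_{k+1}| x^{k+1} - |a_{k}| x^{k} + |a_{k-1}| x^{k-1} + \dots + |a_0| ,$$ $$\sigma(x)=x^{n} + |a_{n-1}| x^{n-1} + \dots + |a_{k+1}| x^{k+1} + |a_{k-1}| x^{k-1} + \dots + |a_0| ,$$ and let $x^{*}$ be the unique positive root of the polynomial $$\chi(x) = (n-k)x^{n} + (n-k-1)|a_{n-1}| x^{n-1} + \dots + |a_{k+1}| x^{k+1} - |a_{k-1}| x^{k-1} - 2|a_{k-2}| x^{k-2} - \dots - k|a_0| .$$ If $$|a_k| > \frac{\sigma(x^{*})}{(x^{*})^{k}} ,$$ then $\phi$ has two distinct positive roots $r$ and $R$ with $r<R$, and $p$ has exactly $k$ zeros in or on the circle $|z|=r$ (that is, satisfying $|z|\le r$) and no zeros in the annular ring $r<|z|<R$.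
   Context: Zeros of $p$ are counted with multiplicity. With the convention $a_n=1$: $\sigma(x)=\sum_{0\le j\le n,\, j\ne k}|a_j|x^j$, $\phi(x)=\sigma(x)-|a_k|x^k$, and $\chi(x)=\sum_{j=0}^n (j-k)|a_j|x^j$. *)

theory Defs
  imports Complex_Main "HOL-Computational_Algebra.Computational_Algebra"
begin

definition pellet_sigma :: "nat \<Rightarrow> complex poly \<Rightarrow> real poly" where
  "pellet_sigma k p = (\<Sum>j\<in>{..degree p} - {k}. monom (cmod (coeff p j)) j)"

definition pellet_phi :: "nat \<Rightarrow> complex poly \<Rightarrow> real poly" where
  "pellet_phi k p = pellet_sigma k p - monom (cmod (coeff p k)) k"

definition pellet_chi :: "nat \<Rightarrow> complex poly \<Rightarrow> real poly" where
  "pellet_chi k p = (\<Sum>j\<le>degree p. monom ((real j - real k) * cmod (coeff p j)) j)"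

text \<open>Meaningful only when \<open>pellet_chi k p\<close> has exactly one positive root; the theorem using
  this definition also asserts that this is the case.\<close>
definition pellet_xstar :: "nat \<Rightarrow> complex poly \<Rightarrow> real" where
  "pellet_xstar k p = (THE x. 0 < x \<and> poly (pellet_chi k p) x = 0)"

end

theory Submission
  imports Defs "HOL-Complex_Analysis.Complex_Analysis"
begin

text \<open>
  Since \<open>x \<phi>'(x) - k \<phi>(x) = \<chi>(x)\<close>, Rolle's theorem applied to \<open>\<phi>(x) / x\<^sup>k\<close> shows that any two
  positive zeros of \<open>\<phi>\<close> are separated by a zero of \<open>\<chi>\<close>. Because \<open>\<chi>(x) / x\<^sup>k\<close> is increasing, \<open>\<chi>\<close> has
  a single positive zero \<open>\<xi>\<close>, and the hypothesis says \<open>\<phi>(\<xi>) < 0\<close>. Hence \<open>\<phi>\<close> has exactly two positive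
  zeros \<open>r < \<xi> < R\<close> and is negative between them: for \<open>r < |z| < R\<close> the term \<open>a\<^sub>k z\<^sup>k\<close> dominates the
  sum of the other terms of \<open>p\<close>, and Rouche's theorem on a circle in the annulus compares the zeros
  of \<open>p\<close> with those of \<open>a\<^sub>k z\<^sup>k\<close>.
\<close>

section \<open>Rouche's theorem as a count of polynomial zeros with multiplicity\<close>

lemma zorder_poly:
  fixes p :: "complex poly"
  assumes "p \<noteq> 0"
  shows "zorder (poly p) a = order a p"
proof -
  obtain q where q: "p = [:-a, 1:] ^ order a p * q" "\<not> [:-a, 1:] dvd q"
    using order_decomp[OF assms] by blast
  show ?thesis
  proof (rule zorder_eqI[of UNIV _ "poly q"])
    show "poly q a \<noteq> 0" using q(2) by (simp add: poly_eq_0_iff_dvd)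
    show "poly p w = poly q w * (w - a) powi int (order a p)" for w
      by (subst q(1)) (simp add: poly_power)
  qed (auto intro!: holomorphic_intros)
qed

text \<open>The circle winds once around each zero inside and not at all around those outside, so
  the weighted sum in \<open>Rouche_theorem\<close> becomes a count of zeros with
  multiplicity.\<close>

lemma winding_sum_zorder_poly:
  fixes p :: "complex poly"
  assumes "p \<noteq> 0" "0 < \<rho>" and nz: "\<And>z. cmod z = \<rho> \<Longrightarrow> poly p z \<noteq> 0"
  shows "(\<Sum>z | poly p z = 0. winding_number (circlepath 0 \<rho>) z * zorder (poly p) z)
    = of_nat (size {#z \<in># proots p. cmod z < \<rho>#})"
proof -
  have fin: "finite {z. poly p z = 0}" using assms(1) by (rule poly_roots_finite)
  have "(\<Sum>z | poly p z = 0. winding_number (circlepath 0 \<rho>) z * zorder (poly p) z)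
      = (\<Sum>z | poly p z = 0. if cmod z < \<rho> then of_nat (order z p) else 0)"
  proof (rule sum.cong[OF refl])
    fix z assume "z \<in> {z. poly p z = 0}"
    then have "cmod z \<noteq> \<rho>" using nz by auto
    then consider "cmod z < \<rho>" | "cmod z > \<rho>" by linarith
    then show "winding_number (circlepath 0 \<rho>) z * zorder (poly p) z
        = (if cmod z < \<rho> then of_nat (order z p) else 0)"
    proof cases
      case 1
      then show ?thesis by (simp add: winding_number_circlepath zorder_poly assms)
    next
      case 2
      have "winding_number (circlepath 0 \<rho>) z = 0"
        by (rule winding_number_zero_outside[of _ "cball 0 \<rho>"])
          (use 2 assms(2) in auto)
      with 2 show ?thesis by simp
    qed
  qed
  also have "\<dots> = of_nat (\<Sum>z\<in>{z. poly p z = 0 \<and> cmod z < \<rho>}. order z p)"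
    using fin by (simp add: sum.inter_filter[symmetric])
  also have "(\<Sum>z\<in>{z. poly p z = 0 \<and> cmod z < \<rho>}. order z p)
      = size {#z \<in># proots p. cmod z < \<rho>#}"
    unfolding size_multiset_overloaded_eq
    using assms(1) by (intro sum.cong) auto
  finally show ?thesis .
qed

lemma Rouche_poly:
  fixes p q :: "complex poly"
  assumes "0 < \<rho>" and less: "\<And>z. cmod z = \<rho> \<Longrightarrow> cmod (poly q z) < cmod (poly p z)"
  shows "size {#z \<in># proots (p + q). cmod z < \<rho>#} = size {#z \<in># proots p. cmod z < \<rho>#}"
proof -
  have nz: "poly p z \<noteq> 0" "poly (p + q) z \<noteq> 0" if "cmod z = \<rho>" for z
    using less[OF that] by (auto simp: add_eq_0_iff2)
  \<comment> \<open>The point \<open>of_real \<rho>\<close> lies on the circle, where neither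
    polynomial vanishes.\<close>
  have nz0: "p \<noteq> 0" "p + q \<noteq> 0"
    using nz[of "of_real \<rho>"] assms(1) by (auto simp del: poly_add)
  have eq: "poly (p + q) = (\<lambda>z. poly p z + poly q z)" by auto
  have "(\<Sum>z\<in>{z \<in> UNIV. poly p z + poly q z = 0}.
        winding_number (circlepath 0 \<rho>) z * zorder (\<lambda>z. poly p z + poly q z) z)
      = (\<Sum>z\<in>{z \<in> UNIV. poly p z = 0}. winding_number (circlepath 0 \<rho>) z * zorder (poly p) z)"
    using poly_roots_finite[OF nz0(1)] poly_roots_finite[OF nz0(2)] less assms(1)
    by (intro Rouche_theorem) (auto intro!: holomorphic_intros)
  then have "(\<Sum>z | poly (p + q) z = 0. winding_number (circlepath 0 \<rho>) z * zorder (poly (p + q)) z)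
      = (\<Sum>z | poly p z = 0. winding_number (circlepath 0 \<rho>) z * zorder (poly p) z)"
    unfolding eq by simp
  then show ?thesis
    using winding_sum_zorder_poly[OF nz0(1) assms(1) nz(1)]
      winding_sum_zorder_poly[OF nz0(2) assms(1) nz(2)] by simp
qed

section \<open>The real polynomials and their positive roots\<close>

lemma coeff_pellet_sigma:
  "coeff (pellet_sigma k p) j = (if j = k then 0 else cmod (coeff p j))"
  by (auto simp: pellet_sigma_def coeff_sum sum.delta' coeff_eq_0)

lemma coeff_pellet_chi:
  "coeff (pellet_chi k p) j = (real j - real k) * cmod (coeff p j)"
  by (auto simp: pellet_chi_def coeff_sum sum.delta' coeff_eq_0)

lemma poly_pellet_sigma:
  "poly (pellet_sigma k p) x = (\<Sum>j\<in>{..degree p} - {k}. cmod (coeff p j) * x ^ j)"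
  by (simp add: pellet_sigma_def poly_sum poly_monom)

lemma poly_pellet_phi:
  "poly (pellet_phi k p) x = poly (pellet_sigma k p) x - cmod (coeff p k) * x ^ k"
  by (simp add: pellet_phi_def poly_monom)

lemma poly_pellet_chi:
  "poly (pellet_chi k p) x = (\<Sum>j\<le>degree p. (real j - real k) * cmod (coeff p j) * x ^ j)"
  by (simp add: pellet_chi_def poly_sum poly_monom)

text \<open>The operator \<open>x d/dx - k\<close> multiplies \<open>x^j\<close> by
  \<open>j - k\<close>. It annihilates the term of degree \<open>k\<close>, so the minus sign of
  that term leaves no trace.\<close>

lemma poly_pellet_chi_pderiv:
  "poly (pellet_chi k p) x
    = x * poly (pderiv (pellet_phi k p)) x - real k * poly (pellet_phi k p) x"
proof -
  have "pellet_chi k p = pCons 0 (pderiv (pellet_phi k p)) - smult (real k) (pellet_phi k p)"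
  proof (rule poly_eqI)
    show "coeff (pellet_chi k p) j
        = coeff (pCons 0 (pderiv (pellet_phi k p)) - smult (real k) (pellet_phi k p)) j" for j
      by (cases j) (auto simp: coeff_pellet_chi pellet_phi_def coeff_pellet_sigma coeff_pderiv
          coeff_pCons algebra_simps)
  qed
  then show ?thesis by simp
qed

text \<open>Every term \<open>(j - k) |a_j| x^(j - k)\<close> of \<open>chi(x) / x^k\<close> is
  nondecreasing for positive \<open>x\<close>, and the term \<open>j = 0\<close> increases
  strictly.\<close>

lemma pellet_chi_pos_mono:
  assumes "1 \<le> k" "coeff p 0 \<noteq> 0" "0 < x" "x < y" "0 \<le> poly (pellet_chi k p) x"
  shows "0 < poly (pellet_chi k p) y"
proof -
  \<comment> \<open>These are the terms of \<open>chi(y) x^k - chi(x) y^k\<close>: the comparison of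
    \<open>chi / x^k\<close> at the two points, cleared of denominators.\<close>
  define t where "t j = (real j - real k) * cmod (coeff p j) * (y ^ j * x ^ k - x ^ j * y ^ k)" for j
  have t: "0 \<le> t j" for j
  proof (cases "k \<le> j")
    case True
    then obtain d where j: "j = k + d" by (auto simp: le_iff_add)
    have "x ^ d \<le> y ^ d" using assms by (intro power_mono) auto
    then have "x ^ j * y ^ k \<le> y ^ j * x ^ k"
      using assms by (simp add: j power_add mult_mono mult.commute mult.left_commute)
    with True show ?thesis unfolding t_def by auto
  next
    case False
    then obtain d where k: "k = j + d" by (metis le_iff_add nat_le_linear)
    have "x ^ d \<le> y ^ d" using assms by (intro power_mono) auto
    then have "y ^ j * x ^ k \<le> x ^ j * y ^ k"
      using assms by (simp add: k power_add mult_mono mult.commute mult.left_commute)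
    with False show ?thesis unfolding t_def by (intro mult_nonpos_nonpos mult_nonpos_nonneg) auto
  qed
  have "x ^ k < y ^ k" using assms by (intro power_strict_mono) auto
  then have "0 < t 0" using assms by (simp add: t_def mult_pos_neg)
  then have "0 < (\<Sum>j\<le>degree p. t j)" using t by (intro sum_pos2[of _ 0]) auto
  also have "\<dots> = poly (pellet_chi k p) y * x ^ k - poly (pellet_chi k p) x * y ^ k"
    unfolding poly_pellet_chi sum_distrib_right sum_subtractf[symmetric] t_def
    by (intro sum.cong refl) (simp add: algebra_simps)
  finally have "poly (pellet_chi k p) x * y ^ k < poly (pellet_chi k p) y * x ^ k" by simp
  moreover have "0 \<le> poly (pellet_chi k p) x * y ^ k" using assms by simp
  ultimately have "0 < poly (pellet_chi k p) y * x ^ k" by linarith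
  then show ?thesis using assms by (simp add: zero_less_mult_iff)
qed

lemma poly_eventually_pos:
  fixes q :: "real poly"
  assumes "0 < lead_coeff q"
  obtains y where "c < y" "0 < poly q y"
proof -
  obtain n where "\<forall>x\<ge>n. lead_coeff q \<le> poly q x" using poly_pinfty_gt_lc[OF assms] by blast
  then have "lead_coeff q \<le> poly q (max n (c + 1))" by simp
  with assms show thesis by (intro that[of "max n (c + 1)"]) auto
qed

text \<open>Existence comes from a sign change: the constant term is negative and the leading
  coefficient positive. After one positive zero, \<open>pellet_chi_pos_mono\<close> leaves no room
  for another.\<close>

lemma ex1_pellet_chi_root:
  assumes "1 \<le> k" "k < degree p" "coeff p 0 \<noteq> 0"
  shows "\<exists>!x. 0 < x \<and> poly (pellet_chi k p) x = 0"
proof -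
  have c: "coeff (pellet_chi k p) (degree p) > 0"
    using assms by (auto simp: coeff_pellet_chi intro!: mult_pos_pos)
  have "degree (pellet_chi k p) \<le> degree p"
    by (rule degree_le) (simp add: coeff_pellet_chi coeff_eq_0)
  then have "degree (pellet_chi k p) = degree p"
    using c by (simp add: le_antisym le_degree)
  then obtain y where y: "0 < y" "0 < poly (pellet_chi k p) y"
    using poly_eventually_pos[of "pellet_chi k p" 0] c by auto
  have "poly (pellet_chi k p) 0 < 0"
    using assms by (simp add: poly_0_coeff_0 coeff_pellet_chi mult_neg_pos)
  then obtain x where x: "0 < x" "poly (pellet_chi k p) x = 0"
    using poly_IVT_pos[OF y(1)] y(2) by blast
  show ?thesis
  proof (rule ex1I[of _ x])
    fix z assume "0 < z \<and> poly (pellet_chi k p) z = 0"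
    then show "z = x"
      using x pellet_chi_pos_mono[OF assms(1,3), of x z] pellet_chi_pos_mono[OF assms(1,3), of z x]
      by (cases x z rule: linorder_cases) auto
  qed (use x in simp)
qed

lemma pellet_chi_root_between:
  assumes "0 < a" "a < b" "poly (pellet_phi k p) a = 0" "poly (pellet_phi k p) b = 0"
  obtains c where "a < c" "c < b" "poly (pellet_chi k p) c = 0"
proof -
  \<comment> \<open>\<open>f\<close> is \<open>phi(x) / x^k\<close> and \<open>f'\<close> is its
    derivative \<open>chi(x) / x^(k+1)\<close>.\<close>
  define f where "f x = poly (pellet_phi k p) x * inverse x ^ k" for x
  define f' where "f' x = poly (pellet_chi k p) x * inverse x ^ Suc k" for x
  have der: "DERIV f x :> f' x" if "0 < x" for x
  proof -
    have "DERIV (\<lambda>x. inverse x ^ k) x :> - (real k * inverse x ^ Suc k)"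
      using DERIV_power[OF DERIV_inverse, of x k UNIV] that by (cases k) (auto simp: algebra_simps)
    from DERIV_mult[OF poly_DERIV[of "pellet_phi k p"] this]
    have "DERIV f x :> poly (pderiv (pellet_phi k p)) x * inverse x ^ k
        - poly (pellet_phi k p) x * (real k * inverse x ^ Suc k)"
      unfolding f_def by (simp add: algebra_simps)
    moreover have "poly (pderiv (pellet_phi k p)) x * inverse x ^ k
        - poly (pellet_phi k p) x * (real k * inverse x ^ Suc k) = f' x"
      using that by (simp add: f'_def poly_pellet_chi_pderiv field_simps)
    ultimately show ?thesis by simp
  qed
  obtain c where c: "a < c" "c < b" "f b - f a = (b - a) * f' c"
    using MVT2[OF assms(2), of f f'] der assms(1) by auto
  have "f' c = 0" using c assms by (simp add: f_def)
  then have "poly (pellet_chi k p) c = 0" using c assms by (simp add: f'_def)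
  with c show thesis using that by blast
qed

lemma pellet_phi_two_roots:
  assumes "1 \<le> k" "k < degree p" "coeff p 0 \<noteq> 0"
    and "0 < x" "poly (pellet_chi k p) x = 0" and neg: "poly (pellet_phi k p) x < 0"
  obtains r R where "0 < r" "r < R" "{x. 0 < x \<and> poly (pellet_phi k p) x = 0} = {r, R}"
    "\<And>y. r < y \<Longrightarrow> y < R \<Longrightarrow> poly (pellet_phi k p) y < 0"
proof -
  let ?\<phi> = "pellet_phi k p"
  have uniq: "y = x" if "0 < y" "poly (pellet_chi k p) y = 0" for y
    using ex1_pellet_chi_root[OF assms(1-3)] assms(4,5) that by blast
  have coeff\<phi>: "coeff ?\<phi> j = (if j = k then - cmod (coeff p k) else cmod (coeff p j))" for j
    by (simp add: pellet_phi_def coeff_pellet_sigma)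
  have c: "coeff ?\<phi> (degree p) > 0" using assms by (auto simp: coeff\<phi>)
  have "degree ?\<phi> \<le> degree p"
    using assms(2) by (intro degree_le) (auto simp: coeff\<phi> coeff_eq_0)
  then have "degree ?\<phi> = degree p" using c by (simp add: le_antisym le_degree)
  then obtain y where y: "x < y" "0 < poly ?\<phi> y"
    using poly_eventually_pos[of ?\<phi> x] c by auto
  obtain R where R: "x < R" "poly ?\<phi> R = 0" using poly_IVT_pos[OF y(1) neg y(2)] by blast
  have "0 < poly ?\<phi> 0" using assms by (simp add: poly_0_coeff_0 coeff\<phi>)
  then obtain r where r: "0 < r" "r < x" "poly ?\<phi> r = 0"
    using poly_IVT_neg[OF assms(4) _ neg] by blast
  \<comment> \<open>The zero of \<open>chi\<close> between \<open>a\<close> and \<open>b\<close> can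
    only be \<open>x\<close>.\<close>
  have sep: "a < x \<and> x < b" if "0 < a" "a < b" "poly ?\<phi> a = 0" "poly ?\<phi> b = 0" for a b
    using pellet_chi_root_between[OF that] uniq that(1) by (metis less_trans)
  \<comment> \<open>A third positive zero would lie on the same side of \<open>x\<close> as
    \<open>r\<close> or \<open>R\<close>, against \<open>sep\<close>.\<close>
  have roots: "y = r \<or> y = R" if "0 < y" "poly ?\<phi> y = 0" for y
  proof (rule ccontr)
    assume "\<not> (y = r \<or> y = R)"
    then have "y < x \<and> y \<noteq> r \<or> x < y \<and> y \<noteq> R" using that neg by (cases "y = x") auto
    then show False
      using sep[of y r] sep[of r y] sep[of y R] sep[of R y] that r R by (auto simp: neq_iff)
  qed
  show thesis
  proof (rule that[of r R])
    show "0 < r" "r < R" using r R by auto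
    show "{x. 0 < x \<and> poly ?\<phi> x = 0} = {r, R}" using roots r R by auto
    fix y assume y: "r < y" "y < R"
    show "poly ?\<phi> y < 0"
    \<comment> \<open>A positive value at \<open>y\<close> would force a further zero of
      \<open>phi\<close> between \<open>x\<close> and \<open>y\<close>, hence strictly between
      \<open>r\<close> and \<open>R\<close>.\<close>
    proof (rule ccontr)
      assume "\<not> poly ?\<phi> y < 0"
      moreover have "poly ?\<phi> y \<noteq> 0" using roots[of y] y r by auto
      ultimately have pos: "0 < poly ?\<phi> y" by simp
      then have "x \<noteq> y" using neg by auto
      then consider "x < y" | "y < x" by linarith
      then obtain z where "r < z" "z < R" "poly ?\<phi> z = 0"
      proof cases
        case 1
        show ?thesis using poly_IVT_pos[OF 1 neg pos] that y r by (meson less_trans)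
      next
        case 2
        show ?thesis using poly_IVT_neg[OF 2 pos neg] that y R by (meson less_trans)
      qed
      then show False using roots[of z] r by auto
    qed
  qed
qed

section \<open>Comparison of \<open>p\<close> with its term of degree \<open>k\<close>\<close>

lemma pellet_dominant:
  assumes "poly (pellet_phi k p) (cmod z) < 0"
  shows "cmod (poly (p - monom (coeff p k) k) z) < cmod (poly (monom (coeff p k) k) z)"
proof -
  have "p - monom (coeff p k) k = (\<Sum>j\<in>{..degree p} - {k}. monom (coeff p j) j)"
    by (rule poly_eqI) (auto simp: coeff_sum sum.delta' coeff_eq_0)
  then have "cmod (poly (p - monom (coeff p k) k) z)
      = cmod (\<Sum>j\<in>{..degree p} - {k}. coeff p j * z ^ j)"
    by (simp add: poly_sum poly_monom)
  also have "\<dots> \<le> (\<Sum>j\<in>{..degree p} - {k}. cmod (coeff p j * z ^ j))" by (rule norm_sum)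
  also have "\<dots> = poly (pellet_sigma k p) (cmod z)"
    by (simp add: poly_pellet_sigma norm_mult norm_power)
  \<comment> \<open>Negativity of \<open>phi\<close> at \<open>|z|\<close> says precisely that
    \<open>sigma(|z|) < |a_k| |z|^k\<close>.\<close>
  also have "\<dots> < cmod (poly (monom (coeff p k) k) z)"
    using assms by (simp add: poly_pellet_phi poly_monom norm_mult norm_power)
  finally show ?thesis .
qed

lemma proots_monom: "c \<noteq> 0 \<Longrightarrow> proots (monom c k) = replicate_mset k (0 :: 'a :: idom)"
proof -
  assume "c \<noteq> 0"
  then have "proots (monom c k) = proots ([:0, 1:] ^ k)"
    by (simp add: monom_altdef)
  also have "\<dots> = replicate_mset k 0"
    by (simp add: proots_power repeat_mset_replicate_mset[of k 1, simplified])
  finally show ?thesis .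
qed

theorem theorem2p2:
  fixes n k :: nat and p :: "complex poly"
  assumes "3 \<le> n" and "1 \<le> k" and "k \<le> n - 1"
    and "degree p = n" and "lead_coeff p = 1"
    and "coeff p 0 * coeff p k \<noteq> 0"
  shows "(\<exists>!x. 0 < x \<and> poly (pellet_chi k p) x = 0) \<and>
    (cmod (coeff p k) > poly (pellet_sigma k p) (pellet_xstar k p) / pellet_xstar k p ^ k \<longrightarrow>
      (\<exists>r R. 0 < r \<and> r < R \<and> {x. 0 < x \<and> poly (pellet_phi k p) x = 0} = {r, R} \<and>
        size {#z \<in># proots p. cmod z \<le> r#} = k \<and>
        (\<forall>z. r < cmod z \<and> cmod z < R \<longrightarrow> poly p z \<noteq> 0)))"
proof (intro conjI impI)
  have k: "k < degree p" and a: "coeff p 0 \<noteq> 0" "coeff p k \<noteq> 0" using assms by auto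
  show ex1: "\<exists>!x. 0 < x \<and> poly (pellet_chi k p) x = 0"
    using ex1_pellet_chi_root assms(2) k a by blast
  let ?x = "pellet_xstar k p"
  have x: "0 < ?x" "poly (pellet_chi k p) ?x = 0"
    using theI'[OF ex1] unfolding pellet_xstar_def by auto
  assume "cmod (coeff p k) > poly (pellet_sigma k p) ?x / ?x ^ k"
  then have "poly (pellet_phi k p) ?x < 0"
    using x by (simp add: poly_pellet_phi divide_simps)
  then obtain r R where rR: "0 < r" "r < R"
      "{x. 0 < x \<and> poly (pellet_phi k p) x = 0} = {r, R}"
      "\<And>y. r < y \<Longrightarrow> y < R \<Longrightarrow> poly (pellet_phi k p) y < 0"
    using pellet_phi_two_roots[OF assms(2) k a(1) x] by blast
  let ?m = "monom (coeff p k) k"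
  have dom: "cmod (poly (p - ?m) z) < cmod (poly ?m z)" if "r < cmod z" "cmod z < R" for z
    using pellet_dominant rR(4) that by blast
  have nz: "poly p z \<noteq> 0" if "r < cmod z" "cmod z < R" for z
    using dom[OF that] by auto
  \<comment> \<open>Any radius strictly between \<open>r\<close> and \<open>R\<close> would
    serve.\<close>
  define \<rho> where "\<rho> = (r + R) / 2"
  have \<rho>: "r < \<rho>" "\<rho> < R" "0 < \<rho>" using rR by (auto simp: \<rho>_def)
  \<comment> \<open>The two counts could differ only by zeros with \<open>r < |z| < \<rho>\<close>,
    which \<open>nz\<close> excludes.\<close>
  have "size {#z \<in># proots p. cmod z \<le> r#} = size {#z \<in># proots p. cmod z < \<rho>#}"
  proof -
    have "p \<noteq> 0" using a by auto
    then have "{#z \<in># proots p. cmod z \<le> r#} = {#z \<in># proots p. cmod z < \<rho>#}"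
      using nz \<rho> by (intro filter_mset_cong refl) (force simp: not_le)
    then show ?thesis by simp
  qed
  also have "\<dots> = size {#z \<in># proots (?m + (p - ?m)). cmod z < \<rho>#}" by simp
  also have "\<dots> = size {#z \<in># proots ?m. cmod z < \<rho>#}"
    using Rouche_poly[OF \<rho>(3)] dom \<rho> by blast
  \<comment> \<open>The only zero of \<open>a_k z^k\<close> is the origin, with multiplicity
    \<open>k\<close>.\<close>
  also have "\<dots> = k" using a \<rho> by (simp add: proots_monom flip: mset_replicate mset_filter)
  finally have "size {#z \<in># proots p. cmod z \<le> r#} = k" .
  with rR nz show "\<exists>r R. 0 < r \<and> r < R \<and> {x. 0 < x \<and> poly (pellet_phi k p) x = 0} = {r, R} \<and>
        size {#z \<in># proots p. cmod z \<le> r#} = k \<and>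
        (\<forall>z. r < cmod z \<and> cmod z < R \<longrightarrow> poly p z \<noteq> 0)"
    by blast
qed

end
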